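(* Let $\{z_t\}_{t\ge1}\subseteq\mathcal Z$ be a deterministic sequence, let $\alpha\in(0,1)$ and $\gamma>0$, and suppose $\mathrm{PI}^t:\mathcal Z^{t-1}\times\mathbb R\to 2^{\mathbb R}$, $t\ge1$, is a sequence of set-constructing functions. Suppose there exist $m$ and $M$ such that for all $t$ and all $z_{1:t-1}\in\mathcal Z^{t-1}$ we have $\mathrm{PI}^t(z_{1:t-1},\theta)=\mathbb R$ for all $\theta>M$, and $\mathrm{PI}^t(z_{1:t-1},\theta)=\emptyset$ for all $\theta<m$. Then the rolling intervals $\{\mathrm{RI}^{\alpha,t}\}_{t\ge1}$ produced by the ACI-DF algorithm (adaptive conformal inference with delayed feedback) satisfy $$\lim_{T\to\infty}\frac1{|S_{T,\Delta}|}\sum_{t\in S_{T,\Delta}}1\{\mathrm{Err}_{\mathrm{sto}}^t\in\mathrm{RI}^{\alpha,t}\}=1-\alpha ,$$ where $S_{T,\Delta}=\{\Delta,2\Delta,3\Delta,\dots,\lfloor T/\Delta\rfloor\cdot\Delta\}$.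
   Context: $z_t=(x_t,y_t)\in\mathcal Z=\mathcal X\times\mathcal Y$. Fixed positive integers $n_{\mathrm{tr}}$ (training size), $n_{\mathrm{te}}$ (test size), and lag $\Delta\ge1$; a forecaster $\hat f:\mathcal X\times\mathcal Z^{n_{\mathrm{tr}}}\to\mathcal Y$ and a loss $\ell:\mathcal Y\times\mathcal Y\to\mathbb R$. The rolling test error is $$\mathrm{Err}_{\mathrm{sto}}^{t+1}=\frac1{n_{\mathrm{te}}}\sum_{s=t+1}^{t+n_{\mathrm{te}}}\ell\big(\hat f(x_s;z_{t-n_{\mathrm{tr}}+1:t}),y_s\big)$$ (for the finitely many early indices at which this is undefined because fewer than $n_{\mathrm{tr}}$ past points exist, it is an arbitrary fixed real number). ACI-DF algorithm, with stepsize $\gamma>0$: let $k$ be the smallest positive integer with $k\Delta\ge n_{\mathrm{te}}$. Initialize $\theta_1=0$. For $t=1,2,\dots$: set $\mathrm{RI}^{\alpha,t}=\mathrm{PI}^t(z_{1:t-1};\theta_t)$; obtain $z_t$; compute $c_{t-n_{\mathrm{te}}+1}=1\{\mathrm{Err}_{\mathrm{sto}}^{t-n_{\mathrm{te}}+1}\in\mathrm{RI}^{\alpha,t-n_{\mathrm{te}}+1}\}$ (for $t\ge n_{\mathrm{te}}$; computable at this time since the error involves data only up to $z_t$). If $\Delta$ divides $t$ and $t>k\Delta$, set $\theta_{t+1}=\theta_{t-\Delta+1}+\gamma\,(1-\alpha-c_{t-k\Delta+1})$; otherwise set $\theta_{t+1}=\theta_t$.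
   Formalization: For Δ≥2 the printed limit can fail, since the feedback only uses coverage at indices 1 mod Δ; the formal conclusion averages 1{Err^{t+1} ∈ RI^{t+1}} over t in S_{T,Δ}, and the printed form with Err^t, RI^t is proved for Δ=1. *)

theory Defs
  imports Complex_Main
begin

text \<open>
  Time starts at 1: in a sequence \<open>z :: nat \<Rightarrow> 'x \<times> 'y\<close> the value \<open>z 0\<close> is never used, and a
  segment $z_{a:b}$ is the list \<open>map z [a..<b + 1]\<close>.  A function on $\mathcal Z^n$ is
  a function on lists that is only applied to lists of length $n$.
\<close>

text \<open>
  \<open>rolling_err f l n_tr n_te e_init z t\<close> is $\mathrm{Err}_{\mathrm{sto}}^{t}$ (superscript $t$, not $t+1$):
  training data $z_{t-n_{tr}:t-1}$, test points $t, \ldots, t+n_{te}-1$.  If fewer than \<open>n_tr\<close> points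
  precede \<open>t\<close>, its value is the arbitrary number \<open>e_init t\<close>.
\<close>
definition rolling_err ::
  "('x \<Rightarrow> ('x \<times> 'y) list \<Rightarrow> 'y) \<Rightarrow> ('y \<Rightarrow> 'y \<Rightarrow> real) \<Rightarrow> nat \<Rightarrow> nat \<Rightarrow> (nat \<Rightarrow> real)
    \<Rightarrow> (nat \<Rightarrow> 'x \<times> 'y) \<Rightarrow> nat \<Rightarrow> real" where
  "rolling_err f l n_tr n_te e_init z t =
     (if n_tr < t
      then (\<Sum>s = t..<t + n_te. l (f (fst (z s)) (map z [t - n_tr..<t])) (snd (z s))) / real n_te
      else e_init t)"

definition feedback_lag :: "nat \<Rightarrow> nat \<Rightarrow> nat" where
  "feedback_lag n_te \<Delta> = (LEAST k. 0 < k \<and> n_te \<le> k * \<Delta>)"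

lemma feedback_lag:
  assumes "0 < \<Delta>"
  shows "0 < feedback_lag n_te \<Delta>" and "n_te \<le> feedback_lag n_te \<Delta> * \<Delta>"
proof -
  have "0 < Suc n_te \<and> n_te \<le> Suc n_te * \<Delta>"
    using assms by (cases \<Delta>) auto
  then have "0 < feedback_lag n_te \<Delta> \<and> n_te \<le> feedback_lag n_te \<Delta> * \<Delta>"
    unfolding feedback_lag_def by (rule LeastI)
  then show "0 < feedback_lag n_te \<Delta>" and "n_te \<le> feedback_lag n_te \<Delta> * \<Delta>" by auto
qed

text \<open>
  The parameter \<open>E\<close> is the sequence of rolling errors.  The index 0 is a dummy; the defining
  equation at \<open>Suc 0\<close> is the initialization $\theta_1 = 0$, and at \<open>Suc t\<close> with $t \ge 1$ it
  is the update made at time $t$, with $c_s$ written out for $s = t - k\Delta + 1$.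
\<close>
function aci_theta ::
  "real \<Rightarrow> real \<Rightarrow> nat \<Rightarrow> nat \<Rightarrow> (nat \<Rightarrow> real) \<Rightarrow> (nat \<Rightarrow> 'z list \<Rightarrow> real \<Rightarrow> real set)
    \<Rightarrow> (nat \<Rightarrow> 'z) \<Rightarrow> nat \<Rightarrow> real" where
  "aci_theta \<alpha> \<gamma> n_te \<Delta> E pset z 0 = 0"
| "aci_theta \<alpha> \<gamma> n_te \<Delta> E pset z (Suc t) =
     (if t = 0 then 0
      else if \<Delta> dvd t \<and> feedback_lag n_te \<Delta> * \<Delta> < t
      then aci_theta \<alpha> \<gamma> n_te \<Delta> E pset z (t - \<Delta> + 1)
           + \<gamma> * (1 - \<alpha> -
               (let s = t - feedback_lag n_te \<Delta> * \<Delta> + 1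
                in of_bool (E s \<in> pset s (map z [1..<s]) (aci_theta \<alpha> \<gamma> n_te \<Delta> E pset z s))))
      else aci_theta \<alpha> \<gamma> n_te \<Delta> E pset z t)"
  by pat_completeness auto
termination
proof (relation "measure (\<lambda>(\<alpha>, \<gamma>, n_te, \<Delta>, E, pset, z, t). t)", goal_cases)
  case 1
  show ?case by simp
next
  case (2 \<alpha> \<gamma> n_te \<Delta> E pset z t)
  then have "0 < \<Delta>" by (auto intro: gr0I)
  with 2 show ?case by auto
next
  case (3 \<alpha> \<gamma> n_te \<Delta> E pset z t x)
  then have "0 < \<Delta>" by (auto intro: gr0I)
  then have "0 < feedback_lag n_te \<Delta> * \<Delta>" by (simp add: feedback_lag)
  with 3 show ?case by auto
next
  case (4 \<alpha> \<gamma> n_te \<Delta> E pset z t)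
  then show ?case by simp
qed

declare aci_theta.simps(2) [simp del]

definition aci_RI ::
  "real \<Rightarrow> real \<Rightarrow> nat \<Rightarrow> nat \<Rightarrow> (nat \<Rightarrow> real) \<Rightarrow> (nat \<Rightarrow> 'z list \<Rightarrow> real \<Rightarrow> real set)
    \<Rightarrow> (nat \<Rightarrow> 'z) \<Rightarrow> nat \<Rightarrow> real set" where
  "aci_RI \<alpha> \<gamma> n_te \<Delta> E pset z t = pset t (map z [1..<t]) (aci_theta \<alpha> \<gamma> n_te \<Delta> E pset z t)"

definition eval_times :: "nat \<Rightarrow> nat \<Rightarrow> nat set" where
  "eval_times T \<Delta> = {j * \<Delta> | j. 1 \<le> j \<and> j \<le> T div \<Delta>}"

text \<open>
  For $\Delta \ge 2$, the coverage averages over \<open>eval_times T \<Delta>\<close> itself need not converge to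
  $1 - \alpha$: the feedback used by the algorithm at a time $t$ divisible by $\Delta$ is
  $c_{t-k\Delta+1}$, whose index is 1 modulo $\Delta$, so coverage at multiples of $\Delta$ is never
  observed.  In the example below all rolling errors are 0, and the intervals at even times
  are empty for all values of $\theta$ that occur.  The quantity that the algorithm controls is
  the coverage of $\mathrm{Err}_{\mathrm{sto}}^{t+1}$ by $\mathrm{RI}^{\alpha,t+1}$, the
  forecaster and the interval built from data up to time $t$, for $t$ in \<open>eval_times T \<Delta>\<close>.
\<close>
lemma unshifted_coverage_fails:
  defines "pset \<equiv> \<lambda>t (w :: (unit \<times> unit) list) (\<theta> :: real).
             if \<theta> > (if even t then 2 else 0) then UNIV else {} :: real set"
    and "E \<equiv> rolling_err (\<lambda>_ _. ()) (\<lambda>_ _. 0) 1 1 (\<lambda>_. 0) (\<lambda>_. ((), ()))"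
  shows "\<forall>t\<ge>1. \<forall>w. length w = t - 1 \<longrightarrow>
           (\<forall>\<theta>>2. pset t w \<theta> = UNIV) \<and> (\<forall>\<theta><0. pset t w \<theta> = {})"
    and "\<not> (\<lambda>T. (\<Sum>t\<in>eval_times T 2. of_bool (E t \<in> aci_RI (1/2) 1 1 2 E pset (\<lambda>_. ((), ())) t))
             / real (card (eval_times T 2)))
           \<longlonglongrightarrow> 1 - 1/2"
proof -
  show "\<forall>t\<ge>1. \<forall>w. length w = t - 1 \<longrightarrow>
           (\<forall>\<theta>>2. pset t w \<theta> = UNIV) \<and> (\<forall>\<theta><0. pset t w \<theta> = {})"
    by (auto simp: pset_def)
  have lag: "feedback_lag 1 2 = 1"
    unfolding feedback_lag_def by (rule Least_equality) auto
  let ?\<theta> = "aci_theta (1/2) 1 1 2 E pset (\<lambda>_. ((), ()))"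
  have step: "\<bar>u + (1/2 - of_bool (u > 0))\<bar> \<le> 1/2" if "\<bar>u\<bar> \<le> 1/2" for u :: real
    using that by (auto simp: of_bool_def abs_if split: if_splits)
  have "\<bar>?\<theta> n\<bar> \<le> 1/2" for n
  proof (induction n rule: less_induct)
    case (less n)
    show ?case
    proof (cases n)
      case (Suc t)
      show ?thesis
      proof (cases "even t \<and> 2 < t")
        case True
        define v where "v = t - 2"
        have t: "t = Suc (Suc v)" using True unfolding v_def by linarith
        have v: "even v" using True unfolding t by simp
        have "Suc v < n" using Suc t by simp
        then have le: "\<bar>?\<theta> (Suc v)\<bar> \<le> 1/2" by (rule less.IH)
        have eq: "t - 2 + 1 = Suc v" "t - 1 * 2 + 1 = Suc v" using t by auto
        have "?\<theta> n = ?\<theta> (Suc v) + (1/2 - of_bool (?\<theta> (Suc v) > 0))"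
          using True v unfolding Suc aci_theta.simps(2) lag eq Let_def
          by (simp add: pset_def)
        with step[OF le] show ?thesis by (simp only:)
      next
        case False
        then have "?\<theta> n = (if t = 0 then 0 else ?\<theta> t)"
          unfolding Suc aci_theta.simps(2) lag by auto
        moreover have "\<bar>?\<theta> t\<bar> \<le> 1/2"
          using Suc by (intro less.IH) simp
        ultimately show ?thesis by (cases "t = 0") simp_all
      qed
    qed simp
  qed
  then have "?\<theta> n \<le> 1/2" for n
    using abs_le_D1 by blast
  then have "?\<theta> n \<le> 2" for n
    by (rule order_trans) simp
  then have empty: "aci_RI (1/2) 1 1 2 E pset (\<lambda>_. ((), ())) t = {}" if "even t" for t
    using that by (auto simp: aci_RI_def pset_def not_less)
  have "even t" if "t \<in> eval_times T 2" for t T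
    using that by (auto simp: eval_times_def)
  then have "(\<lambda>T. (\<Sum>t\<in>eval_times T 2. of_bool (E t \<in> aci_RI (1/2) 1 1 2 E pset (\<lambda>_. ((), ())) t))
             / real (card (eval_times T 2))) = (\<lambda>_. 0 :: real)"
    by (simp add: empty[unfolded One_nat_def] cong: sum.cong)
  then show "\<not> (\<lambda>T. (\<Sum>t\<in>eval_times T 2. of_bool (E t \<in> aci_RI (1/2) 1 1 2 E pset (\<lambda>_. ((), ())) t))
             / real (card (eval_times T 2)))
           \<longlonglongrightarrow> 1 - 1/2"
    by (simp add: LIMSEQ_const_iff)
qed

end

theory Submission
  imports Defs
begin

text \<open>
  Sampled at the times $j\Delta + 1$, the parameter $\theta$ satisfies the delayed recursion
  $\tau_j = \tau_{j-1} + \gamma(1 - \alpha - c_{(j-k)\Delta+1})$ for $j > k$, and the increment is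
  nonpositive when $\tau_{j-k} > M$ and nonnegative when $\tau_{j-k} < m$.  An increase at step $j$
  therefore forces $\tau_{j-k} \le M$, and $k$ steps add at most $k\gamma$, so that $\tau$ is
  bounded.  Telescoping, the partial sums of $1 - \alpha - c_{j\Delta+1}$ are bounded.
\<close>

text \<open>Kept one-sided so that the lower bound follows by applying it to \<open>- x\<close> and
  \<open>- g\<close>. The term \<open>max M 0\<close> covers the initial zeros when \<open>M\<close>
  is negative.\<close>

lemma delayed_recursion_upper_bound:
  fixes x g :: "nat \<Rightarrow> real"
  assumes "0 < k" and "0 \<le> G"
    and init: "\<And>j. j \<le> k \<Longrightarrow> x j = 0"
    and rec: "\<And>i. x (Suc i + k) = x (i + k) + g (Suc i)"
    and le: "\<And>i. g i \<le> G"
    and neg: "\<And>i. M < x i \<Longrightarrow> g i \<le> 0"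
  shows "x n \<le> max M 0 + real k * G"
proof (induction n)
  case 0
  then show ?case using init[of 0] \<open>0 \<le> G\<close> by simp
next
  case (Suc n)
  have nonneg: "0 \<le> real k * G" using \<open>0 \<le> G\<close> by simp
  show ?case
  proof (cases "Suc n \<le> k")
    case True
    then show ?thesis using init[of "Suc n"] nonneg by simp
  next
    case False
    define i where "i = n - k"
    have n: "n = i + k" using False by (simp add: i_def)
    show ?thesis
    \<comment> \<open>The increment leading to \<open>x (Suc n)\<close> is governed by
      \<open>x (Suc i)\<close>, \<open>k\<close> steps earlier. Above \<open>M\<close> it is
      nonpositive and the induction hypothesis suffices; otherwise the climb starts from at most
      \<open>M\<close> and lasts \<open>k\<close> steps.\<close>
    proof (cases "M < x (Suc i)")
      case True
      then show ?thesis using rec[of i] neg[of "Suc i"] Suc n by simp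
    next
      case False
      \<comment> \<open>The window of \<open>k\<close> steps may begin inside the initial segment,
        where the increments are 0.\<close>
      have step: "x (Suc j) \<le> x j + G" for j
      proof (cases "k \<le> j")
        case True
        then show ?thesis using rec[of "j - k"] le[of "Suc (j - k)"] by simp
      next
        case False
        then show ?thesis using init[of j] init[of "Suc j"] \<open>0 \<le> G\<close> by simp
      qed
      have "x (Suc i + d) \<le> x (Suc i) + real d * G" for d
      proof (induction d)
        case (Suc d)
        then show ?case using step[of "Suc i + d"] by (simp add: algebra_simps)
      qed simp
      from this[of k] False n show ?thesis by simp
    qed
  qed
qed

lemma average_tendsto_if_bounded_partial_sums:
  fixes c :: "nat \<Rightarrow> real"
  assumes bounded: "\<And>n. \<bar>\<Sum>i = 1..n. c i - L\<bar> \<le> C"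
  shows "(\<lambda>n. (\<Sum>i = 1..n. c i) / real n) \<longlonglongrightarrow> L"
proof -
  have "(\<lambda>n. (\<Sum>i = 1..n. c i - L) / real n) \<longlonglongrightarrow> 0"
  proof (rule tendsto_0_le[where K = 1])
    show "(\<lambda>n. C / real n) \<longlonglongrightarrow> 0" by (rule lim_const_over_n)
    have "\<bar>\<Sum>i = 1..n. c i - L\<bar> \<le> \<bar>C\<bar>" for n
      using bounded[of n] by linarith
    then show "\<forall>\<^sub>F n in sequentially.
        norm ((\<Sum>i = 1..n. c i - L) / real n) \<le> norm (C / real n) * 1"
      by (intro always_eventually) (simp add: divide_right_mono)
  qed
  then have "(\<lambda>n. (\<Sum>i = 1..n. c i - L) / real n + L) \<longlonglongrightarrow> 0 + L"
    by (intro tendsto_add tendsto_const)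
  \<comment> \<open>Only eventually: at \<open>n = 0\<close> division by zero leaves
    \<open>L\<close> on the left and 0 on the right.\<close>
  moreover have "\<forall>\<^sub>F n in sequentially.
      (\<Sum>i = 1..n. c i - L) / real n + L = (\<Sum>i = 1..n. c i) / real n"
    using eventually_gt_at_top[of 0]
    by eventually_elim (simp add: sum_subtractf field_simps)
  ultimately have "(\<lambda>n. (\<Sum>i = 1..n. c i) / real n) \<longlonglongrightarrow> 0 + L"
    by (rule Lim_transform_eventually)
  then show ?thesis by simp
qed

lemma eval_times_eq_image: "eval_times T \<Delta> = (\<lambda>j. j * \<Delta>) ` {1..T div \<Delta>}"
  by (auto simp: eval_times_def)

lemma eval_times_average:
  fixes h :: "nat \<Rightarrow> real"
  assumes "0 < \<Delta>"
  shows "(\<Sum>t\<in>eval_times T \<Delta>. h t) / real (card (eval_times T \<Delta>)) =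
    (\<Sum>j = 1..T div \<Delta>. h (j * \<Delta>)) / real (T div \<Delta>)"
proof -
  have "inj_on (\<lambda>j. j * \<Delta>) {1..T div \<Delta>}"
    using assms by (intro inj_onI) simp
  then show ?thesis
    by (simp add: eval_times_eq_image sum.reindex card_image)
qed

text \<open>The averages in \<open>T\<close> are ordinary Cesaro averages read along
  \<open>T div \<Delta>\<close>, which tends to infinity.\<close>

lemma eval_times_average_tendsto:
  fixes h :: "nat \<Rightarrow> real"
  assumes "0 < \<Delta>" and "\<And>n. \<bar>\<Sum>j = 1..n. h (j * \<Delta>) - L\<bar> \<le> C"
  shows "(\<lambda>T. (\<Sum>t\<in>eval_times T \<Delta>. h t) / real (card (eval_times T \<Delta>))) \<longlonglongrightarrow> L"
proof -
  have "filterlim (\<lambda>T. T div \<Delta>) at_top sequentially"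
    unfolding filterlim_at_top
  proof
    fix N
    show "\<forall>\<^sub>F T in sequentially. N \<le> T div \<Delta>"
      using eventually_ge_at_top[of "N * \<Delta>"]
      by eventually_elim (use \<open>0 < \<Delta>\<close> in \<open>simp add: less_eq_div_iff_mult_less_eq\<close>)
  qed
  with average_tendsto_if_bounded_partial_sums[OF assms(2)]
  show ?thesis
    unfolding eval_times_average[OF \<open>0 < \<Delta>\<close>] by (rule filterlim_compose)
qed

text \<open>No update happens up to time \<open>k * \<Delta>\<close>, for \<open>k\<close> the
  feedback lag; the update made at time \<open>t\<close> sets the value at \<open>t + 1\<close>,
  hence the extra 1 in the bound.\<close>

lemma aci_theta_eq_0:
  assumes "t \<le> feedback_lag n_te \<Delta> * \<Delta> + 1"
  shows "aci_theta \<alpha> \<gamma> n_te \<Delta> E pset z t = 0"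
  using assms by (induction t) (simp_all add: aci_theta.simps(2))

text \<open>The old parameter and the feedback both sit at indices congruent to 1 modulo \<Delta>,
  so the sampled recursion is closed. The first update, at time \<open>(k + 1) * \<Delta>\<close>,
  reads the feedback at \<open>\<Delta> + 1\<close>, whence \<open>Suc i\<close>.\<close>

lemma aci_theta_delayed_step:
  fixes n_te \<Delta> :: nat
  assumes "0 < \<Delta>"
  defines "k \<equiv> feedback_lag n_te \<Delta>"
  shows "aci_theta \<alpha> \<gamma> n_te \<Delta> E pset z ((Suc i + k) * \<Delta> + 1) =
    aci_theta \<alpha> \<gamma> n_te \<Delta> E pset z ((i + k) * \<Delta> + 1) +
    \<gamma> * (1 - \<alpha> - of_bool (E (Suc i * \<Delta> + 1) \<in> aci_RI \<alpha> \<gamma> n_te \<Delta> E pset z (Suc i * \<Delta> + 1)))"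
proof -
  let ?t = "(Suc i + k) * \<Delta>"
  have "?t \<noteq> 0" "\<Delta> dvd ?t" "k * \<Delta> < ?t"
    using assms(1) by (simp_all add: add_mult_distrib)
  moreover have "?t - \<Delta> + 1 = (i + k) * \<Delta> + 1" "?t - k * \<Delta> + 1 = Suc i * \<Delta> + 1"
    by (simp_all add: algebra_simps)
  ultimately show ?thesis
    unfolding aci_RI_def Suc_eq_plus1[symmetric] aci_theta.simps(2)[where t = ?t] k_def[symmetric]
    by (simp only: Let_def if_False if_True simp_thms Suc_eq_plus1)
qed

lemma aci_coverage_partial_sums_bounded:
  assumes "0 < \<Delta>" and "0 < \<alpha>" and "\<alpha> < 1" and "0 < \<gamma>"
    and thresholds: "\<And>t w. 1 \<le> t \<Longrightarrow> length w = t - 1 \<Longrightarrow>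
      (\<forall>\<theta>>M. pset t w \<theta> = UNIV) \<and> (\<forall>\<theta><m. pset t w \<theta> = {})"
  obtains C where "\<And>n. \<bar>\<Sum>j = 1..n.
      of_bool (E (j * \<Delta> + 1) \<in> aci_RI \<alpha> \<gamma> n_te \<Delta> E pset z (j * \<Delta> + 1)) - (1 - \<alpha>)\<bar> \<le> C"
proof -
  define k where "k = feedback_lag n_te \<Delta>"
  define x where "x j = aci_theta \<alpha> \<gamma> n_te \<Delta> E pset z (j * \<Delta> + 1)" for j
  define c :: "nat \<Rightarrow> real"
    where "c j = of_bool (E (j * \<Delta> + 1) \<in> aci_RI \<alpha> \<gamma> n_te \<Delta> E pset z (j * \<Delta> + 1))" for j
  define g where "g j = \<gamma> * (1 - \<alpha> - c j)" for j
  have "0 < k" unfolding k_def using \<open>0 < \<Delta>\<close> by (rule feedback_lag)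
  have init: "x j = 0" if "j \<le> k" for j
    unfolding x_def using that by (intro aci_theta_eq_0) (simp add: k_def)
  have rec: "x (Suc i + k) = x (i + k) + g (Suc i)" for i
    unfolding x_def g_def c_def k_def using \<open>0 < \<Delta>\<close> by (rule aci_theta_delayed_step)
  \<comment> \<open>The whole line always covers and the empty set never does.\<close>
  have c: "M < x j \<Longrightarrow> c j = 1" "x j < m \<Longrightarrow> c j = 0" for j
  proof -
    have "length (map z [1..<j * \<Delta> + 1]) = j * \<Delta> + 1 - 1"
      by (simp only: length_map length_upt)
    from thresholds[OF _ this]
    show "M < x j \<Longrightarrow> c j = 1" "x j < m \<Longrightarrow> c j = 0"
      unfolding c_def x_def aci_RI_def by simp_all
  qed
  have "0 \<le> c j" "c j \<le> 1" for j by (simp_all add: c_def)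
  \<comment> \<open>\<open>1 - \<alpha> - c j\<close> lies between \<open>- \<alpha>\<close> and
    \<open>1 - \<alpha>\<close>.\<close>
  then have g: "\<gamma> * - 1 \<le> g j" "g j \<le> \<gamma> * 1" for j
    using \<open>0 < \<alpha>\<close> \<open>\<alpha> < 1\<close> \<open>0 < \<gamma>\<close> unfolding g_def
    by (intro mult_left_mono; smt (verit))+
  have sgn: "M < x j \<Longrightarrow> g j \<le> 0" "x j < m \<Longrightarrow> 0 \<le> g j" for j
    using c[of j] \<open>0 < \<alpha>\<close> \<open>\<alpha> < 1\<close> \<open>0 < \<gamma>\<close> by (simp_all add: g_def mult_le_0_iff)
  have upper: "x j \<le> max M 0 + real k * \<gamma>" for j
    using \<open>0 < k\<close> \<open>0 < \<gamma>\<close> init rec g sgn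
    by (intro delayed_recursion_upper_bound[where g = g]) simp_all
  \<comment> \<open>The reflected sequence has threshold \<open>- m\<close>.\<close>
  have lower: "- x j \<le> max (- m) 0 + real k * \<gamma>" for j
    using \<open>0 < k\<close> \<open>0 < \<gamma>\<close> init rec g sgn
    by (intro delayed_recursion_upper_bound[where g = "\<lambda>i. - g i" and x = "\<lambda>i. - x i"])
      (simp_all add: minus_le_iff)
  define B where "B = \<bar>M\<bar> + \<bar>m\<bar> + real k * \<gamma>"
  have x: "\<bar>x j\<bar> \<le> B" for j
    using upper[of j] lower[of j] by (auto simp: B_def)
  \<comment> \<open>The increment \<open>g 1\<close> is the one from \<open>x k = 0\<close> to
    \<open>x (Suc k)\<close>.\<close>
  have telescope: "(\<Sum>j = 1..n. g j) = x (n + k)" for n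
    using init rec by (induction n) simp_all
  have "(\<Sum>j = 1..n. c j - (1 - \<alpha>)) = - x (n + k) / \<gamma>" for n
  proof -
    have "(\<Sum>j = 1..n. c j - (1 - \<alpha>)) = (\<Sum>j = 1..n. - (g j / \<gamma>))"
      using \<open>0 < \<gamma>\<close> by (intro sum.cong) (simp_all add: g_def)
    also have "\<dots> = - x (n + k) / \<gamma>"
      by (simp only: sum_negf sum_divide_distrib[symmetric] telescope minus_divide_left)
    finally show ?thesis .
  qed
  then have "\<bar>\<Sum>j = 1..n. c j - (1 - \<alpha>)\<bar> \<le> B / \<gamma>" for n
    using x[of "n + k"] \<open>0 < \<gamma>\<close> by (simp add: divide_right_mono)
  then show thesis unfolding c_def by (rule that)
qed

text \<open>The shift to \<open>t + 1\<close> matches the indices at which feedback is used. If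
  \<Delta> is 1, shifting the index changes the partial sums only by boundary terms, so the
  unshifted average converges too.\<close>

theorem theorem5p1:
  fixes z :: "nat \<Rightarrow> 'x \<times> 'y"
    and f :: "'x \<Rightarrow> ('x \<times> 'y) list \<Rightarrow> 'y"
    and l :: "'y \<Rightarrow> 'y \<Rightarrow> real"
    and e_init :: "nat \<Rightarrow> real"
    and pset :: "nat \<Rightarrow> ('x \<times> 'y) list \<Rightarrow> real \<Rightarrow> real set"
    and n_tr n_te \<Delta> :: nat
    and \<alpha> \<gamma> :: real
  defines "E \<equiv> rolling_err f l n_tr n_te e_init z"
  defines "RI \<equiv> aci_RI \<alpha> \<gamma> n_te \<Delta> E pset z"
  assumes "1 \<le> n_tr" and "1 \<le> n_te" and "1 \<le> \<Delta>"
    and "0 < \<alpha>" and "\<alpha> < 1" and "0 < \<gamma>"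
    and "\<exists>m M. \<forall>t\<ge>1. \<forall>w. length w = t - 1 \<longrightarrow>
           (\<forall>\<theta>>M. pset t w \<theta> = UNIV) \<and> (\<forall>\<theta><m. pset t w \<theta> = {})"
  shows "((\<lambda>T. (\<Sum>t\<in>eval_times T \<Delta>. of_bool (E (t + 1) \<in> RI (t + 1))) / real (card (eval_times T \<Delta>)))
            \<longlonglongrightarrow> 1 - \<alpha>) \<and>
         (\<Delta> = 1 \<longrightarrow>
          (\<lambda>T. (\<Sum>t\<in>eval_times T \<Delta>. of_bool (E t \<in> RI t)) / real (card (eval_times T \<Delta>)))
            \<longlonglongrightarrow> 1 - \<alpha>)"
proof -
  let ?c = "\<lambda>t. of_bool (E t \<in> RI t) :: real"
  have "0 < \<Delta>" using \<open>1 \<le> \<Delta>\<close> by simp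
  obtain m M where "\<forall>t\<ge>1. \<forall>w. length w = t - 1 \<longrightarrow>
      (\<forall>\<theta>>M. pset t w \<theta> = UNIV) \<and> (\<forall>\<theta><m. pset t w \<theta> = {})"
    using assms(9) by blast
  then obtain C where C: "\<And>n. \<bar>\<Sum>j = 1..n. ?c (j * \<Delta> + 1) - (1 - \<alpha>)\<bar> \<le> C"
    using aci_coverage_partial_sums_bounded[OF \<open>0 < \<Delta>\<close> \<open>0 < \<alpha>\<close> \<open>\<alpha> < 1\<close> \<open>0 < \<gamma>\<close>, of M pset m E n_te z]
    unfolding RI_def by blast
  have "(\<lambda>T. (\<Sum>t\<in>eval_times T \<Delta>. ?c (t + 1)) / real (card (eval_times T \<Delta>))) \<longlonglongrightarrow> 1 - \<alpha>"
    using \<open>0 < \<Delta>\<close> C by (rule eval_times_average_tendsto)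
  moreover have "(\<lambda>T. (\<Sum>t\<in>eval_times T \<Delta>. ?c t) / real (card (eval_times T \<Delta>))) \<longlonglongrightarrow> 1 - \<alpha>"
    if "\<Delta> = 1"
  proof (rule eval_times_average_tendsto[OF \<open>0 < \<Delta>\<close>])
    fix n
    \<comment> \<open>The two boundary terms are indicators, so their difference is at most 1 in
      absolute value; this gives \<open>C + 1\<close>.\<close>
    have "(\<Sum>j = 1..n. ?c j - (1 - \<alpha>)) = (\<Sum>j = 1..n. ?c (j + 1) - (1 - \<alpha>)) + ?c 1 - ?c (n + 1)"
      by (induction n) simp_all
    with C[of n] show "\<bar>\<Sum>j = 1..n. ?c (j * \<Delta>) - (1 - \<alpha>)\<bar> \<le> C + 1"
      unfolding that mult_1_right by (auto simp: of_bool_def split: if_splits)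
  qed
  ultimately show ?thesis by blast
qed

end
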